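(* Let $N\ge 1$, $j\in\{1,\dots,N\}$, $\Delta>0$, $\sigma_0>0$, $b_j>0$, and $\epsilon_0,\delta_0,\epsilon\ge 0$. For a load vector $l=(l_1,\dots,l_N)\in\mathbb R^N$ let $$Z_0=l_1+\dots+l_N+W_0,\qquad Z_j=l_j+W_j,$$ where $W_0\sim\mathcal N(0,\sigma_0^2)$ and $W_j\sim\mathrm{Lap}(b_j)$ are independent. Suppose that, with respect to load changes of a customer at location $j$, $Z_0$ is $(\epsilon_0,\delta_0)$-differentially private and $Z_j$ is $\epsilon$-differentially private. Then the composite measurement $(Z_0,Z_j)$ is $(\epsilon_0+\epsilon,\ \delta_0e^{\epsilon})$-differentially private with respect to load changes of a customer at location $j$.
   Context: $\mathrm{Lap}(b)$ is the zero-mean Laplace distribution with density $\frac{1}{2b}e^{-|w|/b}$. $\Delta$ is a uniform bound on the change of load current of a single customer. Two load vectors $l,l'\in\mathbb R^N$ are adjacent (with respect to a customer at location $j$) if $l_k=l_k'$ for all $k\ne j$ and $|l_j-l_j'|\le\Delta$. A noisy (real- or vector-valued) measurement $M(l,W)$, with $W$ the random noise, is $(\epsilon,\delta)$-differentially private if for all adjacent $l,l'$ and all measurable events $E$ in the output space, $\Pr[M(l,W)\in E]\le e^{\epsilon}\Pr[M(l',W)\in E]+\delta$. It is called $\epsilon$-differentially private if this holds with $\delta=0$. For the composite measurement the output space is $\mathbb R^2$. *)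

theory Defs
  imports "HOL-Probability.Probability"
begin

definition laplace_density :: "real \<Rightarrow> real \<Rightarrow> real" where
  "laplace_density b w = 1 / (2 * b) * exp (- \<bar>w\<bar> / b)"

text \<open>Load vectors of \<open>N\<close> customers are elements of \<open>real ^ 'n\<close>, so \<open>N = CARD('n)\<close>.\<close>

definition adjacent :: "real \<Rightarrow> 'n \<Rightarrow> real ^ 'n \<Rightarrow> real ^ 'n \<Rightarrow> bool" where
  "adjacent \<Delta> j l l' \<longleftrightarrow> (\<forall>k. k \<noteq> j \<longrightarrow> l $ k = l' $ k) \<and> \<bar>l $ j - l' $ j\<bar> \<le> \<Delta>"

text \<open>A noisy measurement is a family \<open>Z\<close> of random variables on the probability space \<open>M\<close>
  that carries the noise, indexed by the load vector. Measurability is required because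
  \<open>measure\<close> is 0 on non-measurable sets.\<close>

definition approx_diff_private ::
  "'w measure \<Rightarrow> real \<Rightarrow> 'n \<Rightarrow> (real ^ 'n \<Rightarrow> 'w \<Rightarrow> 'b::topological_space) \<Rightarrow> real \<Rightarrow> real \<Rightarrow> bool"
where
  "approx_diff_private M \<Delta> j Z \<epsilon> \<delta> \<longleftrightarrow>
     (\<forall>l. Z l \<in> borel_measurable M) \<and>
     (\<forall>l l'. adjacent \<Delta> j l l' \<longrightarrow>
       (\<forall>E \<in> sets borel.
          measure M {\<omega> \<in> space M. Z l \<omega> \<in> E}
            \<le> exp \<epsilon> * measure M {\<omega> \<in> space M. Z l' \<omega> \<in> E} + \<delta>))"

definition diff_private ::
  "'w measure \<Rightarrow> real \<Rightarrow> 'n \<Rightarrow> (real ^ 'n \<Rightarrow> 'w \<Rightarrow> 'b::topological_space) \<Rightarrow> real \<Rightarrow> bool"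
where
  "diff_private M \<Delta> j Z \<epsilon> \<longleftrightarrow> approx_diff_private M \<Delta> j Z \<epsilon> 0"

end

theory Submission
  imports Defs
begin

text \<open>
  Write \<open>P0, P1\<close> for the laws of the two measurements under one load vector and \<open>Q0, Q1\<close> for
  those under an adjacent one. The noises are independent, so the composite measurement has law
  \<open>P0 \<Otimes>\<^sub>M P1\<close>, respectively \<open>Q0 \<Otimes>\<^sub>M Q1\<close>. An event \<open>E\<close> in the plane is measured by integrating the
  measures of its horizontal slices. On every slice, \<open>P0\<close> may be exchanged for
  \<open>exp \<epsilon>0 * Q0 + \<delta>0\<close>; afterwards \<open>P1 \<le> exp \<epsilon> * Q1\<close>, an inequality of measures and hence of
  integrals of nonnegative functions, replaces \<open>P1\<close> by \<open>Q1\<close>. This second exchange multiplies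
  everything, including the additive \<open>\<delta>0\<close>, by \<open>exp \<epsilon>\<close>. The exchange is
  \<open>emeasure_pair_measure_le\<close>; \<open>approx_diff_private_Pair\<close> reads it as a composition rule for
  privacy.
\<close>

text \<open>
  The bound on the first factor has an additive error and is no inequality between measures, so it
  is applied to the slices of \<open>E\<close>, which are sets. The bound on the second factor is one, so it
  extends to the integrals over the slices that remain.
\<close>

lemma emeasure_pair_measure_le:
  fixes c d k :: ennreal
  assumes "prob_space P0" "prob_space Q0" "prob_space P1" "prob_space Q1"
    and sets0: "sets P0 = sets Q0" and sets1: "sets P1 = sets Q1"
    and le0: "\<And>A. A \<in> sets Q0 \<Longrightarrow> emeasure P0 A \<le> c * emeasure Q0 A + d"
    and le1: "\<And>B. B \<in> sets Q1 \<Longrightarrow> emeasure P1 B \<le> k * emeasure Q1 B"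
    and E: "E \<in> sets (Q0 \<Otimes>\<^sub>M Q1)"
  shows "emeasure (P0 \<Otimes>\<^sub>M P1) E \<le> k * c * emeasure (Q0 \<Otimes>\<^sub>M Q1) E + k * d"
proof -
  interpret P0: prob_space P0 by fact
  interpret Q0: prob_space Q0 by fact
  interpret P1: prob_space P1 by fact
  interpret Q1: prob_space Q1 by fact
  interpret P: pair_prob_space P0 P1 ..
  interpret Q: pair_prob_space Q0 Q1 ..
  let ?S = "\<lambda>y. (\<lambda>x. (x, y)) -` E"
  have EP: "E \<in> sets (P0 \<Otimes>\<^sub>M P1)"
    using E sets_pair_measure_cong[OF sets0 sets1] by simp
  have slice: "?S y \<in> sets Q0" for y
    using E by (rule sets_Pair2)
  have meas [measurable]: "(\<lambda>y. emeasure Q0 (?S y)) \<in> borel_measurable Q1"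
    using E by (rule Q.measurable_emeasure_Pair2)
  \<comment> \<open>Stated in the order on measures, so that it carries over to integrals.\<close>
  have le: "P1 \<le> scale_measure k Q1"
    using le1 sets1 by (subst le_measure) simp_all
  have "emeasure (P0 \<Otimes>\<^sub>M P1) E = (\<integral>\<^sup>+ y. emeasure P0 (?S y) \<partial>P1)"
    using EP by (rule P.emeasure_pair_measure_alt2)
  also have "\<dots> \<le> (\<integral>\<^sup>+ y. c * emeasure Q0 (?S y) + d \<partial>P1)"
    by (intro nn_integral_mono le0 slice)
  also have "\<dots> \<le> (\<integral>\<^sup>+ y. c * emeasure Q0 (?S y) + d \<partial>scale_measure k Q1)"
    using sets1 le by (intro nn_integral_mono_measure) auto
  also have "\<dots> = k * (\<integral>\<^sup>+ y. c * emeasure Q0 (?S y) + d \<partial>Q1)"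
    by (rule nn_integral_scale_measure) measurable
  also have "\<dots> = k * (c * (\<integral>\<^sup>+ y. emeasure Q0 (?S y) \<partial>Q1) + d)"
    by (simp add: nn_integral_add nn_integral_cmult Q1.emeasure_space_1)
  also have "(\<integral>\<^sup>+ y. emeasure Q0 (?S y) \<partial>Q1) = emeasure (Q0 \<Otimes>\<^sub>M Q1) E"
    using E by (rule Q.emeasure_pair_measure_alt2[symmetric])
  finally show ?thesis
    by (simp add: distrib_left mult.assoc)
qed

lemma (in prob_space) emeasure_distr_borel_eq_measure:
  assumes "f \<in> borel_measurable M" "A \<in> sets borel"
  shows "emeasure (distr M borel f) A = ennreal (measure M {\<omega> \<in> space M. f \<omega> \<in> A})"
  using assms by (simp add: emeasure_distr emeasure_eq_measure vimage_def Int_def conj_commute)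

text \<open>
  Privacy depends only on the laws of the outputs, and independence makes the law of the pair a
  product, so the bound for product measures applies at each two adjacent load vectors.
\<close>

lemma approx_diff_private_Pair:
  fixes X Y :: "real ^ 'n \<Rightarrow> 'w \<Rightarrow> 'a::second_countable_topology"
    and j :: "'n::finite"
  assumes "prob_space M"
    and indep: "\<And>l. prob_space.indep_var M borel (X l) borel (Y l)"
    and X: "approx_diff_private M \<Delta> j X \<epsilon>0 \<delta>0" and "\<delta>0 \<ge> 0"
    and Y: "diff_private M \<Delta> j Y \<epsilon>"
  shows "approx_diff_private M \<Delta> j (\<lambda>l \<omega>. (X l \<omega>, Y l \<omega>)) (\<epsilon>0 + \<epsilon>) (\<delta>0 * exp \<epsilon>)"
proof -
  interpret prob_space M by fact
  have mX [measurable]: "X l \<in> borel_measurable M" for l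
    using X by (simp add: approx_diff_private_def)
  have mY [measurable]: "Y l \<in> borel_measurable M" for l
    using Y by (simp add: diff_private_def approx_diff_private_def)
  let ?Z = "\<lambda>l \<omega>. (X l \<omega>, Y l \<omega>)"
  have law: "distr M borel (X l) \<Otimes>\<^sub>M distr M borel (Y l) = distr M borel (?Z l)" for l
    using indep[of l] by (simp add: indep_var_distribution_eq borel_prod)
  note em = emeasure_distr_borel_eq_measure
  have "measure M {\<omega> \<in> space M. ?Z l \<omega> \<in> E}
      \<le> exp (\<epsilon>0 + \<epsilon>) * measure M {\<omega> \<in> space M. ?Z l' \<omega> \<in> E} + \<delta>0 * exp \<epsilon>"
    if adj: "adjacent \<Delta> j l l'" and E: "E \<in> sets borel" for l l' E
  proof -
    have "emeasure (distr M borel (X l)) A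
        \<le> ennreal (exp \<epsilon>0) * emeasure (distr M borel (X l')) A + ennreal \<delta>0"
      if A: "A \<in> sets borel" for A
      using X adj A \<open>\<delta>0 \<ge> 0\<close>
      by (simp add: approx_diff_private_def em flip: ennreal_mult ennreal_plus)
    moreover have "emeasure (distr M borel (Y l)) B
        \<le> ennreal (exp \<epsilon>) * emeasure (distr M borel (Y l')) B"
      if B: "B \<in> sets borel" for B
      using Y adj B
      by (simp add: diff_private_def approx_diff_private_def em flip: ennreal_mult)
    moreover have "E \<in> sets (distr M borel (X l') \<Otimes>\<^sub>M distr M borel (Y l'))"
      unfolding law using E by simp
    ultimately have "emeasure (distr M borel (?Z l)) E
        \<le> ennreal (exp \<epsilon>) * ennreal (exp \<epsilon>0) * emeasure (distr M borel (?Z l')) E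
          + ennreal (exp \<epsilon>) * ennreal \<delta>0"
      unfolding law[symmetric]
      by (intro emeasure_pair_measure_le prob_space_distr) simp_all
    then show ?thesis
      using E \<open>\<delta>0 \<ge> 0\<close>
      by (simp add: em exp_add mult.commute mult.left_commute
          flip: ennreal_mult ennreal_plus)
  qed
  then show ?thesis
    by (simp add: approx_diff_private_def)
qed

theorem theorem1:
  fixes M :: "'w measure"
    and W0 Wj :: "'w \<Rightarrow> real"
    and j :: "'n::finite"
    and \<Delta> \<sigma>0 bj \<epsilon>0 \<delta>0 \<epsilon> :: real
  assumes "prob_space M"
    and "\<Delta> > 0" and "\<sigma>0 > 0" and "bj > 0"
    and "\<epsilon>0 \<ge> 0" and "\<delta>0 \<ge> 0" and "\<epsilon> \<ge> 0"
    and "distributed M lborel W0 (normal_density 0 \<sigma>0)"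
    and "distributed M lborel Wj (laplace_density bj)"
    and "prob_space.indep_var M borel W0 borel Wj"
    and "approx_diff_private M \<Delta> j (\<lambda>l \<omega>. (\<Sum>k\<in>UNIV. l $ k) + W0 \<omega>) \<epsilon>0 \<delta>0"
    and "diff_private M \<Delta> j (\<lambda>l \<omega>. l $ j + Wj \<omega>) \<epsilon>"
  shows "approx_diff_private M \<Delta> j
           (\<lambda>l \<omega>. ((\<Sum>k\<in>UNIV. l $ k) + W0 \<omega>, l $ j + Wj \<omega>))
           (\<epsilon>0 + \<epsilon>) (\<delta>0 * exp \<epsilon>)"
proof -
  interpret prob_space M by fact
  \<comment> \<open>The load only shifts the noises, and shifts preserve independence.\<close>
  have "indep_var borel ((\<lambda>x. (\<Sum>k\<in>UNIV. l $ k) + x) \<circ> W0) borel ((\<lambda>x. l $ j + x) \<circ> Wj)"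
    for l :: "real ^ 'n"
    using assms(10) by (rule indep_var_compose) auto
  then show ?thesis
    using assms(6,11,12) by (intro approx_diff_private_Pair prob_space_axioms) (simp_all add: comp_def)
qed

end
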